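(* There is an absolute constant $C>0$ such that for every prime $n$ the domination number of the discrete torus $T_n$ satisfies $D_n^T \le C\sqrt{n\log n}$; that is, $D_n^T=O(\sqrt{n\log n})$ for $n$ prime.
   Context: The discrete $n\times n$ torus is $T_n=\{0,1,\dots,n-1\}\times\{0,1,\dots,n-1\}$, and $\pi_n:\mathbb Z\times\mathbb Z\to T_n$ is $\pi_n(x_1,x_2)=(x_1 \bmod n,\ x_2\bmod n)$, where $a \bmod b$ is the smallest non-negative remainder. A line in $\mathbb Z\times\mathbb Z$ is the intersection with $\mathbb Z\times\mathbb Z$ of a straight line in the plane through at least two integer points. A line on the torus $T_n$ is the image under $\pi_n$ of a line in $\mathbb Z\times\mathbb Z$. A set of points of $T_n$ is collinear if it is contained in a line on the torus. A point $p\in T_n$ is dominated by $S\subseteq T_n$ if $p\in S$ or there exist two distinct points $x,y\in S$ such that $\{x,y,p\}$ is collinear on the torus. $S$ is a dominating set of $T_n$ if every point of $T_n$ is dominated by $S$. The domination number $D_n^T$ is the smallest size of a dominating set of $T_n$. *)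

theory Defs
  imports "HOL-Analysis.Analysis" "HOL-Computational_Algebra.Primes"
begin

definition torus :: "nat \<Rightarrow> (int \<times> int) set" where
  "torus n = {0..<int n} \<times> {0..<int n}"

definition torus_proj :: "nat \<Rightarrow> int \<times> int \<Rightarrow> int \<times> int" where
  "torus_proj n x = (fst x mod int n, snd x mod int n)"

definition real_point :: "int \<times> int \<Rightarrow> real \<times> real" where
  "real_point x = (real_of_int (fst x), real_of_int (snd x))"

definition straight_line :: "(real \<times> real) set \<Rightarrow> bool" where
  "straight_line M \<longleftrightarrow> affine M \<and> aff_dim M = 1"

definition lattice_line :: "(int \<times> int) set \<Rightarrow> bool" where
  "lattice_line L \<longleftrightarrow>
     (\<exists>M. straight_line M \<and> L = {x. real_point x \<in> M} \<and> (\<exists>x\<in>L. \<exists>y\<in>L. x \<noteq> y))"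

definition torus_line :: "nat \<Rightarrow> (int \<times> int) set \<Rightarrow> bool" where
  "torus_line n K \<longleftrightarrow> (\<exists>L. lattice_line L \<and> K = torus_proj n ` L)"

definition torus_collinear :: "nat \<Rightarrow> (int \<times> int) set \<Rightarrow> bool" where
  "torus_collinear n A \<longleftrightarrow> (\<exists>K. torus_line n K \<and> A \<subseteq> K)"

definition dominated :: "nat \<Rightarrow> (int \<times> int) set \<Rightarrow> int \<times> int \<Rightarrow> bool" where
  "dominated n S p \<longleftrightarrow>
     p \<in> S \<or> (\<exists>x\<in>S. \<exists>y\<in>S. x \<noteq> y \<and> torus_collinear n {x, y, p})"

definition dominating_set :: "nat \<Rightarrow> (int \<times> int) set \<Rightarrow> bool" where
  "dominating_set n S \<longleftrightarrow> S \<subseteq> torus n \<and> (\<forall>p\<in>torus n. dominated n S p)"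

text \<open>For \<open>n > 0\<close> the minimum exists, since \<open>torus n\<close> is finite and dominates itself.
  (For \<open>n = 0\<close>, where \<open>torus 0\<close> is empty, the value is \<open>0\<close>.)\<close>

definition domination_number :: "nat \<Rightarrow> nat" where
  "domination_number n = (LEAST k. \<exists>S. dominating_set n S \<and> card S = k)"

end

theory Submission
  imports Defs "HOL-Number_Theory.Cong"
begin

text \<open>
  The dominating set is built greedily. If \<open>p\<close> is not dominated by \<open>S\<close>, then the \<open>card S\<close> lines
  joining \<open>p\<close> to \<open>S\<close> are distinct, so for prime \<open>n\<close> they cover at least \<open>(n - 2) * card S\<close> points
  \<open>q\<close> outside \<open>insert p S\<close>, each of which makes \<open>insert q S\<close> dominate \<open>p\<close>. Averaging over \<open>q\<close>, some
  \<open>q\<close> lowers the number \<open>u\<close> of undominated points to at most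
  \<open>u * (1 - card S * (n - 2) / n\<^sup>2)\<close>. Since \<open>n - 2 \<ge> n / 3\<close> for \<open>n \<ge> 3\<close>, after \<open>k\<close> steps at most
  \<open>n\<^sup>2 * exp (- k * (k - 1) / (6 * n))\<close> points remain, which is below \<open>1\<close> as soon as
  \<open>k * (k - 1) > 12 * n * ln n\<close>.
\<close>

section \<open>Lines through a point of the torus\<close>

definition ray :: "nat \<Rightarrow> int \<times> int \<Rightarrow> int \<times> int \<Rightarrow> int \<Rightarrow> int \<times> int" where
  "ray n p x t = torus_proj n (fst p + t * (fst x - fst p), snd p + t * (snd x - snd p))"

text \<open>In the real line through \<open>a\<close> and \<open>a + v\<close>, the affine
  combination with coefficients \<open>1 - s\<close> and \<open>s\<close> is
  \<open>a + s * v\<close>, so a single lattice line holds all the required lifts.\<close>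

lemma torus_collinear_lattice_translates:
  assumes "v \<noteq> (0, 0)"
    and "\<And>q. q \<in> A \<Longrightarrow> \<exists>s. q = torus_proj n (fst a + s * fst v, snd a + s * snd v)"
  shows "torus_collinear n A"
proof -
  define b where "b = (fst a + fst v, snd a + snd v)"
  define M where "M = affine hull {real_point a, real_point b}"
  define L where "L = {x. real_point x \<in> M}"
  have ab: "a \<noteq> b" using assms(1) by (auto simp: b_def prod_eq_iff)
  have "real_point a \<noteq> real_point b" using ab by (auto simp: real_point_def prod_eq_iff)
  then have "straight_line M" by (simp add: straight_line_def M_def)
  moreover have mem: "(fst a + s * fst v, snd a + s * snd v) \<in> L" for s
  proof -
    have "real_point (fst a + s * fst v, snd a + s * snd v)
        = (1 - real_of_int s) *\<^sub>R real_point a + real_of_int s *\<^sub>R real_point b"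
      by (simp add: real_point_def b_def algebra_simps)
    then show ?thesis
      unfolding L_def M_def affine_hull_2 mem_Collect_eq
      by (intro exI[of _ "1 - real_of_int s"] exI[of _ "real_of_int s"]) simp
  qed
  moreover have "a \<in> L" "b \<in> L" using mem[of 0] mem[of 1] by (simp_all add: b_def)
  ultimately have "lattice_line L"
    unfolding lattice_line_def using ab L_def by blast
  moreover have "A \<subseteq> torus_proj n ` L" using assms(2) mem by blast
  ultimately show ?thesis unfolding torus_collinear_def torus_line_def by blast
qed

lemma torus_proj_torus: "x \<in> torus n \<Longrightarrow> torus_proj n x = x"
  by (auto simp: torus_def torus_proj_def)

lemma torus_proj_eq_iff:
  "torus_proj n x = torus_proj n y \<longleftrightarrow>
     [fst x = fst y] (mod int n) \<and> [snd x = snd y] (mod int n)"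
  by (simp add: torus_proj_def cong_def)

lemma ray_in_torus: "n > 0 \<Longrightarrow> ray n p x t \<in> torus n"
  by (simp add: ray_def torus_proj_def torus_def)

lemma prime_cong_inverse:
  assumes "prime n" "\<not> int n dvd a"
  obtains b where "[a * b = 1] (mod int n)"
proof -
  have "coprime a (int n)"
    using assms by (metis coprime_commute prime_imp_coprime prime_nat_int_transfer)
  then show ?thesis using that cong_solve_coprime_int by blast
qed

text \<open>Lattice lines of direction \<open>(1, m)\<close> and \<open>(0, 1)\<close> already suffice.\<close>

lemma torus_collinear_ray:
  assumes n: "prime n" and p: "p \<in> torus n" and x: "x \<in> torus n"
  shows "torus_collinear n {x, ray n p x t, p}"
proof -
  define d1 d2 where "d1 = fst x - fst p" and "d2 = snd x - snd p"
  \<comment> \<open>The pair \<open>(d1, d2)\<close> is zero when \<open>x = p\<close>, so it is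
    replaced by a nonzero direction \<open>v\<close> of which it is a multiple modulo
    \<open>n\<close>.\<close>
  have "\<exists>v c. v \<noteq> (0, 0) \<and> [d1 = c * fst v] (mod int n) \<and> [d2 = c * snd v] (mod int n)"
  proof (cases "int n dvd d1")
    case True
    then show ?thesis by (intro exI[of _ "(0, 1)"] exI[of _ d2]) (simp add: cong_0_iff)
  next
    case False
    then obtain b where b: "[d1 * b = 1] (mod int n)" using prime_cong_inverse[OF n] by blast
    have "[d2 = d1 * (b * d2)] (mod int n)"
      using cong_scalar_right[OF b, of d2] by (simp add: cong_sym_eq mult.assoc)
    then show ?thesis by (intro exI[of _ "(1, b * d2)"] exI[of _ d1]) simp
  qed
  then obtain v c where v: "v \<noteq> (0, 0)"
    and c: "[d1 = c * fst v] (mod int n)" "[d2 = c * snd v] (mod int n)" by blast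
  have r: "ray n p x s = torus_proj n (fst p + (s * c) * fst v, snd p + (s * c) * snd v)" for s
    unfolding ray_def torus_proj_eq_iff
    using cong_scalar_left[OF c(1), of s] cong_scalar_left[OF c(2), of s]
    by (auto simp: d1_def d2_def mult.assoc intro: cong_add_lcancel[THEN iffD2])
  have "x = ray n p x 1" "p = ray n p x 0"
    using p x by (simp_all add: ray_def torus_proj_torus)
  then show ?thesis
    by (intro torus_collinear_lattice_translates[OF v, of _ _ p]) (metis r insertE empty_iff)
qed

text \<open>Two lines through \<open>p\<close> that meet at a parameter invertible modulo
  \<open>n\<close> coincide: multiplying by the inverse of \<open>s\<close> expresses
  \<open>x\<close> by a parameter on the line of \<open>y\<close>.\<close>

lemma ray_cancel:
  assumes n: "prime n" and s: "s \<in> {1..<int n}"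
    and eq: "ray n p x s = ray n p y t" and x: "x \<in> torus n"
  obtains u where "x = ray n p y u"
proof -
  have "\<not> int n dvd s" using s by (auto dest: zdvd_imp_le)
  then obtain b where b: "[s * b = 1] (mod int n)" using prime_cong_inverse[OF n] by blast
  have inv: "[a + d = a + (b * t) * e] (mod int n)"
    if "[a + s * d = a + t * e] (mod int n)" for a d e
  proof -
    have "[s * d = t * e] (mod int n)" using that by (simp only: cong_add_lcancel)
    then have "[b * (s * d) = b * t * e] (mod int n)"
      unfolding mult.assoc by (rule cong_scalar_left)
    moreover have "[b * (s * d) = d] (mod int n)"
      using cong_scalar_right[OF b, of d] by (simp add: mult_ac)
    ultimately have "[d = b * t * e] (mod int n)" by (metis cong_sym cong_trans)
    then show ?thesis by (simp only: cong_add_lcancel)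
  qed
  have "[fst x = fst p + (b * t) * (fst y - fst p)] (mod int n)"
    "[snd x = snd p + (b * t) * (snd y - snd p)] (mod int n)"
    using eq inv[of "fst p" "fst x - fst p" "fst y - fst p"]
      inv[of "snd p" "snd x - snd p" "snd y - snd p"]
    by (simp_all add: ray_def torus_proj_eq_iff)
  then have "torus_proj n x = ray n p y (b * t)"
    by (simp add: ray_def torus_proj_eq_iff)
  then show ?thesis using that torus_proj_torus[OF x] by simp
qed

text \<open>The difference of the two points is \<open>s - t\<close> times the vector from
  \<open>p\<close> to \<open>x\<close>. As \<open>x\<close> and \<open>p\<close> are distinct points
  of the torus, some coordinate of that vector is nonzero modulo the prime \<open>n\<close>, so
  \<open>n\<close> divides \<open>s - t\<close>.\<close>

lemma ray_inj:
  assumes n: "prime n" and p: "p \<in> torus n" and x: "x \<in> torus n" and ne: "x \<noteq> p"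
    and s: "s \<in> {0..<int n}" and t: "t \<in> {0..<int n}" and eq: "ray n p x s = ray n p x t"
  shows "s = t"
proof -
  have key: "int n dvd (s - t) * d" if "[a + s * d = a + t * d] (mod int n)" for a d
    using that by (simp add: cong_iff_dvd_diff left_diff_distrib)
  have d: "int n dvd (s - t) * (fst x - fst p)" "int n dvd (s - t) * (snd x - snd p)"
    using eq by (auto simp: ray_def torus_proj_eq_iff intro: key)
  have "\<not> (int n dvd fst x - fst p \<and> int n dvd snd x - snd p)"
  proof
    assume "int n dvd fst x - fst p \<and> int n dvd snd x - snd p"
    then have "torus_proj n x = torus_proj n p" by (simp add: torus_proj_eq_iff cong_iff_dvd_diff)
    then show False using ne p x by (simp add: torus_proj_torus)
  qed
  moreover have "prime (int n)" using n by simp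
  ultimately have "int n dvd s - t" using d by (metis prime_dvd_mult_iff)
  then have "[s = t] (mod int n)" by (simp add: cong_iff_dvd_diff)
  then show ?thesis using s t by (simp add: cong_def)
qed

section \<open>Counting the points that help to dominate\<close>

definition undominated :: "nat \<Rightarrow> (int \<times> int) set \<Rightarrow> (int \<times> int) set" where
  "undominated n S = {p \<in> torus n. \<not> dominated n S p}"

lemma finite_torus [simp]: "finite (torus n)"
  by (simp add: torus_def)

lemma card_torus: "card (torus n) = n\<^sup>2"
  by (simp add: torus_def card_cartesian_product power2_eq_square)

lemma finite_undominated [simp]: "finite (undominated n S)"
  by (simp add: undominated_def)

lemma dominated_mono: "dominated n S p \<Longrightarrow> S \<subseteq> S' \<Longrightarrow> dominated n S' p"
  unfolding dominated_def by (meson subsetD)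

text \<open>If the rays from \<open>p\<close> through distinct \<open>x\<close> and \<open>y\<close>
  in \<open>S\<close> shared one of the points counted, then \<open>x\<close>, \<open>y\<close> and
  \<open>p\<close> would be collinear and \<open>p\<close> would be dominated already.\<close>

lemma card_dominating_extensions:
  assumes n: "prime n" and S: "S \<subseteq> torus n" and p: "p \<in> undominated n S"
  shows "card S * (n - 2) \<le> card {q \<in> torus n. dominated n (insert q S) p}"
proof -
  have pT: "p \<in> torus n" and nd: "\<not> dominated n S p" using p by (auto simp: undominated_def)
  then have pS: "p \<notin> S" by (auto simp: dominated_def)
  have n0: "n > 0" using n by (simp add: prime_gt_0_nat)
  \<comment> \<open>Parameters 0 and 1 are left out: they give \<open>p\<close>, common to all rays,
    and \<open>x\<close> itself, which adds no second point.\<close>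
  let ?f = "\<lambda>(x, t). ray n p x t" and ?D = "S \<times> {2..<int n}"
  have nocol: "\<not> torus_collinear n {x, y, p}" if "x \<in> S" "y \<in> S" "x \<noteq> y" for x y
    using nd that unfolding dominated_def by blast
  have "inj_on ?f ?D"
  proof (rule inj_onI)
    fix z w
    assume z: "z \<in> ?D" and w: "w \<in> ?D" and "?f z = ?f w"
    then obtain x y s t where zw: "z = (x, s)" "w = (y, t)" and eq: "ray n p x s = ray n p y t"
      by (cases z, cases w) auto
    then have a: "x \<in> S" "y \<in> S" "s \<in> {2..<int n}" "t \<in> {2..<int n}" using z w by auto
    obtain u where "x = ray n p y u"
      using ray_cancel[OF n _ eq] a S by auto
    then have "torus_collinear n {y, x, p}"
      using torus_collinear_ray[OF n pT, of y u] a S by auto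
    then have xy: "x = y" using nocol[of y x] a by blast
    moreover have "s = t"
      using ray_inj[OF n pT, of x s t] a S pS eq xy by auto
    ultimately show "z = w" by (simp add: zw)
  qed
  moreover have "nat (int n - 2) = n - 2" by arith
  ultimately have "card (?f ` ?D) = card S * (n - 2)"
    by (simp add: card_image card_cartesian_product)
  moreover have "?f ` ?D \<subseteq> {q \<in> torus n. dominated n (insert q S) p}"
  proof
    fix q
    assume "q \<in> ?f ` ?D"
    then obtain x t where q: "q = ray n p x t" and a: "x \<in> S" "t \<in> {2..<int n}" by auto
    have "x \<noteq> ray n p x t"
    proof
      have "ray n p x 1 = x" using torus_proj_torus[of x n] a S by (auto simp: ray_def)
      moreover assume "x = ray n p x t"
      ultimately have "1 = t" using ray_inj[OF n pT, of x 1 t] a S pS by auto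
      then show False using a by simp
    qed
    then show "q \<in> {q \<in> torus n. dominated n (insert q S) p}"
      using torus_collinear_ray[OF n pT, of x t] a S ray_in_torus[OF n0]
      unfolding dominated_def q by blast
  qed
  moreover have "finite {q \<in> torus n. dominated n (insert q S) p}" by simp
  ultimately show ?thesis by (metis (no_types, lifting) card_mono)
qed

text \<open>Double counting of the pairs of an undominated \<open>p\<close> and a \<open>q\<close>
  that repairs it; the average over the \<open>n\<^sup>2\<close> choices of \<open>q\<close> is
  stated without division.\<close>

lemma exists_good_extension:
  assumes n: "prime n" and S: "S \<subseteq> torus n"
  shows "\<exists>q\<in>torus n. card (undominated n S) * (card S * (n - 2))
           \<le> n\<^sup>2 * card {p \<in> undominated n S. dominated n (insert q S) p}"
proof (rule ccontr)
  let ?U = "undominated n S" and ?m = "card (undominated n S) * (card S * (n - 2))"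
  let ?c = "\<lambda>q. card {p \<in> undominated n S. dominated n (insert q S) p}"
  assume "\<not> ?thesis"
  then have less: "n\<^sup>2 * ?c q < ?m" if "q \<in> torus n" for q using that by force
  have n0: "n > 0" using n by (simp add: prime_gt_0_nat)
  then have ne: "torus n \<noteq> {}" by (auto simp: torus_def)
  have "n\<^sup>2 * ?m \<le> n\<^sup>2 * (\<Sum>p\<in>?U. card {q \<in> torus n. dominated n (insert q S) p})"
    using sum_bounded_below[of ?U "card S * (n - 2)"
        "\<lambda>p. card {q \<in> torus n. dominated n (insert q S) p}"]
      card_dominating_extensions[OF n S] by (intro mult_left_mono) auto
  also have "(\<Sum>p\<in>?U. card {q \<in> torus n. dominated n (insert q S) p}) = (\<Sum>q\<in>torus n. ?c q)"
    using sum_multicount_gen[of "torus n" ?U "\<lambda>q p. dominated n (insert q S) p"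
        "\<lambda>p. card {q \<in> torus n. dominated n (insert q S) p}"] by simp
  also have "n\<^sup>2 * (\<Sum>q\<in>torus n. ?c q) = (\<Sum>q\<in>torus n. n\<^sup>2 * ?c q)"
    by (simp add: sum_distrib_left)
  also have "\<dots> < (\<Sum>q\<in>torus n. ?m)" using less ne by (intro sum_strict_mono) auto
  also have "\<dots> = n\<^sup>2 * ?m" by (simp add: card_torus)
  finally show False by simp
qed

section \<open>The greedy construction\<close>

lemma greedy_step:
  assumes n: "prime n" "n \<ge> 3" and S: "S \<subseteq> torus n"
    and nonempty: "undominated n S \<noteq> {}"
  shows "\<exists>q\<in>torus n. q \<notin> S \<and> real (card (undominated n (insert q S)))
           \<le> card (undominated n S) * exp (- (card S / (3 * n)))"
proof -
  let ?U = "undominated n S"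
  show ?thesis
  proof (cases "card S = 0")
    \<comment> \<open>For empty \<open>S\<close> the exponential factor is 1 and averaging gives
      nothing, so any new point will do.\<close>
    case True
    then have "S = {}" using finite_subset[OF S] by simp
    moreover have "(0, 0) \<in> torus n" using n by (simp add: torus_def)
    moreover have "card (undominated n {(0, 0)}) \<le> card (undominated n {})"
      using dominated_mono[of n "{}" _ "{(0, 0)}"]
      by (intro card_mono) (auto simp: undominated_def)
    ultimately show ?thesis by (intro bexI[of _ "(0, 0)"]) auto
  next
    case False
    obtain q where q: "q \<in> torus n"
      and le: "card ?U * (card S * (n - 2)) \<le> n\<^sup>2 * card {p \<in> ?U. dominated n (insert q S) p}"
      using exists_good_extension[OF n(1) S] by blast
    let ?c = "card {p \<in> ?U. dominated n (insert q S) p}"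
    \<comment> \<open>A positive gain shows that \<open>q\<close> is new, since inserting a member
      of \<open>S\<close> changes nothing. This keeps the size of the set equal to the number of
      steps.\<close>
    have "card ?U > 0" using nonempty by (simp add: card_gt_0_iff)
    then have "card ?U * (card S * (n - 2)) > 0" using False n by simp
    then have "?c \<noteq> 0" using le by (intro notI) simp
    then have "{p \<in> ?U. dominated n (insert q S) p} \<noteq> {}" by (intro notI) simp
    then obtain p where "p \<in> ?U" "dominated n (insert q S) p" by blast
    then have qS: "q \<notin> S" by (auto simp: undominated_def insert_absorb)
    have "undominated n (insert q S) = ?U - {p \<in> ?U. dominated n (insert q S) p}"
      using dominated_mono[of n S _ "insert q S"] by (auto simp: undominated_def)
    then have "card (undominated n (insert q S)) = card ?U - ?c"
      by (simp add: card_Diff_subset)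
    moreover have "?c \<le> card ?U" by (intro card_mono) auto
    ultimately have card_eq: "real (card (undominated n (insert q S))) = real (card ?U) - real ?c"
      by (simp add: of_nat_diff)
    have "real (card ?U * (card S * (n - 2))) \<le> real (n\<^sup>2 * ?c)"
      using le by (simp only: of_nat_le_iff)
    then have "real (card ?U) * (real (card S) * (real n - 2)) \<le> (real n)\<^sup>2 * real ?c"
      using n(2) by (simp add: of_nat_diff)
    \<comment> \<open>Here \<open>n - 2 \<ge> n / 3\<close> is used, which is an equality at
      \<open>n = 3\<close>.\<close>
    moreover have "real (card ?U) * (real (card S) * (real n / 3))
        \<le> real (card ?U) * (real (card S) * (real n - 2))"
      using n(2) by (intro mult_left_mono) auto
    ultimately have "real (card ?U) * (real (card S) * (real n / 3)) \<le> (real n)\<^sup>2 * real ?c"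
      by linarith
    then have "real (card ?U) * (real (card S) / (3 * real n)) \<le> real ?c"
      using n(2) by (simp add: field_simps power2_eq_square)
    then have "real (card (undominated n (insert q S)))
        \<le> real (card ?U) * (1 + (- (real (card S) / (3 * real n))))"
      using card_eq by (simp add: algebra_simps)
    also have "\<dots> \<le> real (card ?U) * exp (- (real (card S) / (3 * real n)))"
      by (intro mult_left_mono exp_ge_add_one_self) auto
    finally show ?thesis using q qS by blast
  qed
qed

text \<open>The exponent is the sum of \<open>j / (3 * n)\<close> over \<open>j < k\<close>. The
  first alternative allows the process to stop early.\<close>

lemma greedy_dominating:
  assumes n: "prime n" "n \<ge> 3"
  shows "\<exists>S\<subseteq>torus n. card S \<le> k \<and> (undominated n S = {} \<or>
           card S = k \<and> real (card (undominated n S))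
             \<le> (real n)\<^sup>2 * exp (- (real k * (real k - 1) / (6 * real n))))"
proof (induction k)
  case 0
  have "card (undominated n {}) \<le> card (torus n)"
    by (intro card_mono) (auto simp: undominated_def)
  then have "real (card (undominated n {})) \<le> (real n)\<^sup>2"
    by (metis card_torus of_nat_le_iff of_nat_power)
  then show ?case by (intro exI[of _ "{}"]) auto
next
  case (Suc k)
  then obtain S where S: "S \<subseteq> torus n" "card S \<le> k" and
    alt: "undominated n S = {} \<or> card S = k \<and> real (card (undominated n S))
             \<le> (real n)\<^sup>2 * exp (- (real k * (real k - 1) / (6 * real n)))" by blast
  show ?case
  proof (cases "undominated n S = {}")
    case True
    then show ?thesis using S by (intro exI[of _ S]) auto
  next
    case False
    obtain q where q: "q \<in> torus n" "q \<notin> S" and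
      le: "real (card (undominated n (insert q S)))
             \<le> real (card (undominated n S)) * exp (- (real (card S) / (3 * real n)))"
      using greedy_step[OF n S(1) False] by auto
    have k: "card S = k" and
      b: "real (card (undominated n S)) \<le> (real n)\<^sup>2 * exp (- (real k * (real k - 1) / (6 * real n)))"
      using alt False by blast+
    have "finite S" using S(1) by (rule finite_subset) simp
    then have card: "card (insert q S) = Suc k" using q k by simp
    have "real (card (undominated n (insert q S)))
        \<le> ((real n)\<^sup>2 * exp (- (real k * (real k - 1) / (6 * real n)))) * exp (- (real k / (3 * real n)))"
      using le[unfolded k] mult_right_mono[OF b exp_ge_zero] by (rule order_trans)
    also have "\<dots> = (real n)\<^sup>2 * exp (- (real (Suc k) * (real (Suc k) - 1) / (6 * real n)))"
    proof -
      have "- (real k * (real k - 1) / (6 * real n)) + - (real k / (3 * real n))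
          = - (real (Suc k) * (real (Suc k) - 1) / (6 * real n))"
        using n(2) by (simp add: field_simps)
      then show ?thesis by (simp only: mult.assoc flip: exp_add)
    qed
    finally show ?thesis using q(1) S(1) card by (intro exI[of _ "insert q S"]) simp
  qed
qed

section \<open>From the decay estimate to the bound\<close>

lemma domination_number_le: "dominating_set n S \<Longrightarrow> domination_number n \<le> card S"
  unfolding domination_number_def by (intro Least_le) blast

lemma dominating_set_torus: "dominating_set n (torus n)"
  by (simp add: dominating_set_def dominated_def)

lemma domination_number_prime_le:
  assumes n: "prime n" "n \<ge> 3" and k: "real k * (real k - 1) > 12 * (real n * ln (real n))"
  shows "domination_number n \<le> k"
proof -
  obtain S where S: "S \<subseteq> torus n" "card S \<le> k" and
    alt: "undominated n S = {} \<or> real (card (undominated n S))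
             \<le> (real n)\<^sup>2 * exp (- (real k * (real k - 1) / (6 * real n)))"
    using greedy_dominating[OF n] by blast
  have "undominated n S = {}"
  proof (rule ccontr)
    assume ne: "undominated n S \<noteq> {}"
    \<comment> \<open>The constant 12 is 2 times 6: the 2 comes from the \<open>n\<^sup>2\<close>
      initial points, the 6 from the decay rate. The remaining count is then below 1, hence
      zero.\<close>
    have "2 * ln (real n) < real k * (real k - 1) / (6 * real n)"
      using n(2) k by (simp add: field_simps)
    then have "exp (- (real k * (real k - 1) / (6 * real n))) < exp (- (2 * ln (real n)))" by simp
    also have "\<dots> = inverse ((real n)\<^sup>2)"
      using n(2) by (simp add: exp_minus exp_double)
    finally have "(real n)\<^sup>2 * exp (- (real k * (real k - 1) / (6 * real n))) < 1"
      using n(2) by (simp add: field_simps)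
    then have "real (card (undominated n S)) < 1" using alt ne by linarith
    then show False using ne by simp
  qed
  then have "dominating_set n S" using S by (auto simp: dominating_set_def undominated_def)
  then show ?thesis using domination_number_le S(2) le_trans by blast
qed

theorem theorem8:
  shows "\<exists>C::real. C > 0 \<and>
    (\<forall>n::nat. prime n \<longrightarrow>
      real (domination_number n) \<le> C * sqrt (real n * ln (real n)))"
\<comment> \<open>The choice of \<open>k\<close> below gives at most \<open>4 * r + 2\<close>, and
  \<open>r \<ge> 1\<close> absorbs the additive constant into \<open>7 * r\<close>.\<close>
proof (intro exI[of _ 7] conjI allI impI)
  fix n :: nat
  assume n: "prime n"
  define r where "r = sqrt (real n * ln (real n))"
  have n2: "n \<ge> 2" using n by (rule prime_ge_2_nat)
  have "1 / 2 \<le> ln (2::real)" using ln2_ge_two_thirds by simp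
  also have "\<dots> \<le> ln (real n)" using n2 by simp
  finally have "2 * (1 / 2) \<le> real n * ln (real n)" using n2 by (intro mult_mono) auto
  then have r1: "r \<ge> 1" and r2: "r\<^sup>2 = real n * ln (real n)" by (simp_all add: r_def)
  have "real (domination_number n) \<le> 7 * r"
  \<comment> \<open>The greedy bound starts at \<open>n = 3\<close>; for \<open>n = 2\<close> the
    whole torus has only 4 points.\<close>
  proof (cases "n = 2")
    case True
    then have "domination_number n \<le> 4"
      using domination_number_le[OF dominating_set_torus, of 2] by (simp add: card_torus)
    then show ?thesis using r1 by linarith
  next
    case False
    \<comment> \<open>With \<open>k - 1 \<ge> 4 * r\<close> the product \<open>k * (k - 1)\<close>
      is at least \<open>16 * r\<^sup>2\<close>, which exceeds the required
      \<open>12 * r\<^sup>2\<close>.\<close>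
    define k where "k = nat \<lceil>4 * r + 1\<rceil>"
    have k: "4 * r + 1 \<le> real k" "real k \<le> 4 * r + 2"
      using r1 by (simp_all add: k_def) linarith+
    have "12 * (real n * ln (real n)) < (4 * r) * (4 * r)"
      using r1 r2 by (simp add: power2_eq_square[symmetric] flip: r2)
    also have "\<dots> \<le> real k * (real k - 1)" using k r1 by (intro mult_mono) auto
    finally have "domination_number n \<le> k"
      using domination_number_prime_le n n2 False by auto
    then show ?thesis using k r1 by linarith
  qed
  then show "real (domination_number n) \<le> 7 * sqrt (real n * ln (real n))" by (simp add: r_def)
qed simp

end
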